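(* Let $\alpha,\beta>-1$ be real, let $n\ge1$ be an integer, let $c$ be a constant and let $P^{(\alpha,\beta)}_{n;c}(x)=P^{(\alpha,\beta)}_n(x)+c\,P^{(\alpha,\beta)}_{n-1}(x)$. Then \[ \begin{aligned} \operatorname{disc}(P^{(\alpha,\beta)}_{n;c})&=\frac{(2n+\alpha+\beta)^{2n-1}}{2^{n(n-1)}}\prod_{k=1}^nk^{k-2n+3}\cdot\prod_{k=1}^{n-1}(k+\alpha)^{k-1}(k+\beta)^{k-1}(n+k+\alpha+\beta)^{n-k-1}\\ &\quad\cdot\frac{(-c)^nP^{(\alpha,\beta)}_{n;c}\left(-\frac{2n(n+\alpha+\beta)c^2+(\alpha^2-\beta^2)c+2(n+\alpha)(n+\beta)}{(2n+\alpha+\beta)^2c}\right)}{(n+\alpha+cn)(n+\beta-cn)}. \end{aligned} \] Furthermore, $\operatorname{disc}(P^{(\alpha,\beta)}_{n;c})$ is a polynomial in $c$ of degree $2(n-1)$.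
   Context: $P^{(\alpha,\beta)}_n$ is the $n$-th Jacobi polynomial, $P^{(\alpha,\beta)}_n(x)=\frac{(-1)^n}{2^nn!}(1-x)^{-\alpha}(1+x)^{-\beta}\frac{d^n}{dx^n}\left((1-x)^{n+\alpha}(1+x)^{n+\beta}\right)=\sum_{m=0}^n\binom{n+\alpha}{m}\binom{n+\beta}{n-m}\left(\frac{x-1}{2}\right)^{n-m}\left(\frac{x+1}{2}\right)^m$. Constants are real or complex numbers. For $f=a_0\prod_{i=1}^n(x-\alpha_i)$ of degree $n$, $\operatorname{disc}(f)=a_0^{2n-2}\prod_{1\le i<j\le n}(\alpha_i-\alpha_j)^2$. The displayed formula is an identity of rational functions in $c$: it holds literally where $c\ne0$ and the denominators are nonzero, and at the remaining values of $c$ the right-hand side (whose singularities are removable) is read by continuity. *)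

theory Defs
  imports "HOL-Analysis.Analysis" "HOL-Computational_Algebra.Computational_Algebra"
begin

text \<open>
  The Jacobi polynomial $P_n^{(\alpha,\beta)}$ as an element of the polynomial ring, given by the
  explicit sum to which Rodrigues' formula expands; the binomials are generalised binomial
  coefficients and the two linear factors are $(x-1)/2$ and $(x+1)/2$.
\<close>
definition jacobi_poly :: "'a :: field_char_0 \<Rightarrow> 'a \<Rightarrow> nat \<Rightarrow> 'a poly" where
  "jacobi_poly \<alpha> \<beta> n =
     (\<Sum>m\<le>n. smult (((of_nat n + \<alpha>) gchoose m) * ((of_nat n + \<beta>) gchoose (n - m)))
              ([:-1/2, 1/2:] ^ (n - m) * [:1/2, 1/2:] ^ m))"

text \<open>Only meant for $n \ge 1$, because of the truncated subtraction.\<close>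
definition quasi_jacobi_poly :: "'a :: field_char_0 \<Rightarrow> 'a \<Rightarrow> nat \<Rightarrow> 'a \<Rightarrow> 'a poly" where
  "quasi_jacobi_poly \<alpha> \<beta> n c = jacobi_poly \<alpha> \<beta> n + smult c (jacobi_poly \<alpha> \<beta> (n - 1))"

text \<open>
  The roots are listed with multiplicity in an arbitrary order; the lemma
  \<open>poly_disc_eq\<close> below shows that the order does not matter.  Over the complex numbers
  there are exactly \<open>degree f\<close> of them.
\<close>
definition poly_disc :: "complex poly \<Rightarrow> complex" where
  "poly_disc f =
     (let n = degree f; rs = (SOME rs. mset rs = proots f)
      in lead_coeff f ^ (2 * n - 2) * (\<Prod>j<n. \<Prod>i<j. (rs ! i - rs ! j)\<^sup>2))"

lemma prod_square_diff_perm: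
  fixes xs ys :: "complex list"
  assumes "mset xs = mset ys"
  shows "(\<Prod>j<length xs. \<Prod>i<j. (xs ! i - xs ! j)\<^sup>2) =
         (\<Prod>j<length ys. \<Prod>i<j. (ys ! i - ys ! j)\<^sup>2)"
proof -
  define D :: "complex list \<Rightarrow> complex" where
    "D zs = (\<Prod>j<length zs. \<Prod>i<j. (zs ! i - zs ! j)\<^sup>2)" for zs
  have D_snoc: "D (zs @ [x]) = D zs * (\<Prod>y\<in>#mset zs. (y - x)\<^sup>2)" for zs x
  proof -
    have "(\<Prod>y\<in>#mset zs. (y - x)\<^sup>2) = (\<Prod>i<length zs. (zs ! i - x)\<^sup>2)"
      by (induction zs rule: rev_induct) (simp_all add: nth_append mult.commute)
    moreover have "(\<Prod>j<length zs. \<Prod>i<j. ((zs @ [x]) ! i - (zs @ [x]) ! j)\<^sup>2) = D zs"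
      unfolding D_def by (intro prod.cong refl) (auto simp: nth_append)
    moreover have "(\<Prod>i<length zs. ((zs @ [x]) ! i - (zs @ [x]) ! length zs)\<^sup>2)
                     = (\<Prod>i<length zs. (zs ! i - x)\<^sup>2)"
      by (intro prod.cong refl) (auto simp: nth_append)
    ultimately show ?thesis
      unfolding D_def by simp
  qed
  have move: "D (us @ x # vs) = D (us @ vs @ [x])" for us x vs
  proof (induction vs rule: rev_induct)
    case (snoc v vs)
    have 1: "D (us @ x # vs @ [v]) = D (us @ vs @ [x]) * (\<Prod>y\<in>#mset (us @ x # vs). (y - v)\<^sup>2)"
      using D_snoc[of "us @ x # vs" v] snoc.IH by simp
    have 2: "D (us @ vs @ [x]) = D (us @ vs) * (\<Prod>y\<in>#mset (us @ vs). (y - x)\<^sup>2)"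
      using D_snoc[of "us @ vs" x] by simp
    have 3: "D (us @ vs @ [v, x]) = D (us @ vs) * (\<Prod>y\<in>#mset (us @ vs). (y - v)\<^sup>2) *
               (\<Prod>y\<in>#mset (us @ vs @ [v]). (y - x)\<^sup>2)"
      using D_snoc[of "us @ vs @ [v]" x]
            D_snoc[of "us @ vs" v] by simp
    show ?case
      using 1 2 3 by (simp add: power2_commute[of x v] mult_ac)
  qed auto
  have "D xs = D ys" using assms
  proof (induction xs arbitrary: ys rule: rev_induct)
    case (snoc x xs)
    then have "x \<in> set ys"
      by (metis in_set_conv_decomp mset_eq_setD)
    then obtain us vs where ys: "ys = us @ x # vs"
      by (meson split_list)
    with snoc.prems have "mset xs = mset (us @ vs)" by simp
    then show ?case
      using snoc.IH[of "us @ vs"] ys move[of us x vs]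
            D_snoc[of xs x] D_snoc[of "us @ vs" x]
      by simp
  qed auto
  then show ?thesis unfolding D_def .
qed

lemma proots_smult_linear_factors:
  fixes a :: complex
  assumes "a \<noteq> 0"
  shows "proots (smult a (\<Prod>r\<leftarrow>rs. [:-r, 1:])) = mset rs"
proof -
  have nz: "(\<Prod>r\<leftarrow>rs. [:-r, 1:]) \<noteq> 0" for rs :: "complex list"
    by (auto simp: prod_list_zero_iff)
  have "proots (\<Prod>r\<leftarrow>rs. [:-r, 1:]) = mset rs"
  proof (induction rs)
    case (Cons r rs)
    have "[:-r, 1:] * (\<Prod>r\<leftarrow>rs. [:-r, 1:]) \<noteq> 0"
      using nz[of "r # rs"] by simp
    then show ?case
      using Cons.IH by (simp add: proots_mult del: mult_pCons_left)
  qed auto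
  then show ?thesis using assms by simp
qed

lemma poly_disc_eq:
  assumes "f = smult a (\<Prod>r\<leftarrow>rs. [:-r, 1:])" "a \<noteq> 0"
  shows "poly_disc f =
           a ^ (2 * length rs - 2) * (\<Prod>j<length rs. \<Prod>i<j. (rs ! i - rs ! j)\<^sup>2)"
proof -
  define ss where "ss = (SOME ss. mset ss = proots f)"
  have "mset rs = proots f"
    using proots_smult_linear_factors[OF assms(2)] assms(1) by simp
  then have ss: "mset ss = mset rs"
    unfolding ss_def by (metis (mono_tags, lifting) someI)
  have deg: "degree (\<Prod>r\<leftarrow>rs. [:-r, 1:]) = length rs \<and>
             lead_coeff (\<Prod>r\<leftarrow>rs. [:-r, 1:]) = 1" for rs :: "complex list"
  proof (induction rs)
    case (Cons r rs)
    then have "(\<Prod>r\<leftarrow>rs. [:-r, 1:]) \<noteq> 0" by auto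
    with Cons.IH have "degree (\<Prod>r\<leftarrow>rs. [:-r, 1:]) = length rs"
        "coeff (\<Prod>r\<leftarrow>rs. [:-r, 1:]) (length rs) = 1"
        "(\<Prod>r\<leftarrow>rs. [:-r, 1:]) \<noteq> 0"
      by auto
    then show ?case
      using lead_coeff_mult[of "[:-r, 1:]" "\<Prod>r\<leftarrow>rs. [:-r, 1:]"]
      by (simp add: degree_mult_eq del: mult_pCons_left)
  qed auto
  have "degree f = length rs" "lead_coeff f = a"
    using deg[of rs] assms by auto
  then have "poly_disc f = a ^ (2 * length rs - 2) * (\<Prod>j<length rs. \<Prod>i<j. (ss ! i - ss ! j)\<^sup>2)"
    unfolding poly_disc_def Let_def ss_def by simp
  moreover have "length ss = length rs"
    using ss by (metis size_mset)
  ultimately show ?thesis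
    using prod_square_diff_perm[OF ss] by simp
qed

end

theory Submission
  imports Defs
begin

text \<open>
  Write \<open>P\<^sub>n\<close> for the Jacobi polynomials, \<open>f = P\<^sub>n + c P\<^sub>n\<^sub>-\<^sub>1\<close> and
  \<open>N = 2n + \<alpha> + \<beta>\<close>.  Up to a sign and a power of the leading coefficient, the discriminant
  of \<open>f\<close> is the product of \<open>f'(r)\<close> over the roots \<open>r\<close> of \<open>f\<close>
  (\<open>poly_disc_eq_prod_pderiv\<close>), and everything comes from evaluating that product in two ways.
  
  The first way gives the formula, in the manner of Schur's computation of the discriminants of the
  classical orthogonal polynomials.  The two structure relations express \<open>(1 - x\<^sup>2) P\<^sub>n'\<close>
  and \<open>(1 - x\<^sup>2) P\<^sub>n\<^sub>-\<^sub>1'\<close> as combinations of \<open>P\<^sub>n\<close> and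
  \<open>P\<^sub>n\<^sub>-\<^sub>1\<close> with coefficients of degree at most one in \<open>x\<close>.  At a root \<open>r\<close> of
  \<open>f\<close> the value \<open>P\<^sub>n(r)\<close> is \<open>-c P\<^sub>n\<^sub>-\<^sub>1(r)\<close>, so that
  \<open>(1 - r\<^sup>2) f'(r) = N c (r - y) P\<^sub>n\<^sub>-\<^sub>1(r)\<close>, where \<open>y\<close> does not depend on \<open>r\<close>;
  it is the argument that appears in the theorem (\<open>quasi_jacobi_pderiv_at_root\<close>).  Multiplying over
  all \<open>r\<close>, and up to constants, the factors \<open>1 - r\<^sup>2\<close> give \<open>f(1) f(-1)\<close>, which is the denominator; the factors
  \<open>r - y\<close> give \<open>f(y)\<close>; and the factors \<open>P\<^sub>n\<^sub>-\<^sub>1(r)\<close> give the resultant of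
  \<open>f\<close> and \<open>P\<^sub>n\<^sub>-\<^sub>1\<close>, which equals that of \<open>P\<^sub>n\<close> and \<open>P\<^sub>n\<^sub>-\<^sub>1\<close>
  because resultants are reciprocal (\<open>prod_proots_swap\<close>).  The last resultant is computed
  recursively (\<open>\<rho>_Suc\<close>): at the roots of \<open>P\<^sub>n\<close> the polynomials \<open>P\<^sub>n\<^sub>+\<^sub>1\<close> and
  \<open>P\<^sub>n\<^sub>-\<^sub>1\<close> are proportional.
  
  The second way gives the polynomial dependence on \<open>c\<close> and holds for every pencil
  \<open>P + c Q\<close> of coprime polynomials of degrees \<open>n\<close> and \<open>n - 1\<close> in which
  \<open>Q\<close> has simple roots (\<open>disc_pencil_eq_poly\<close>).  At a root \<open>r\<close> of \<open>f = P + c Q\<close> the product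
  \<open>f'(r) Q(r)\<close> is the Wronskian \<open>W(r) = P'(r) Q(r) - P(r) Q'(r)\<close>, in which \<open>c\<close> no longer
  occurs.  By reciprocity the product of \<open>W(r)\<close> over the roots of \<open>f\<close> becomes the product of
  \<open>P(w) + c Q(w)\<close> over the \<open>2n - 2\<close> roots \<open>w\<close> of \<open>W\<close>: visibly a polynomial in
  \<open>c\<close>, of degree exactly \<open>2n - 2\<close> since no \<open>Q(w)\<close> vanishes.  The limits at the
  exceptional values of \<open>c\<close> follow, because the right-hand side agrees with this polynomial at all
  but finitely many points.
\<close>

section \<open>Resultants and discriminants in terms of roots\<close>

lemma poly_eq_prod_proots:
  fixes f :: "complex poly"
  shows "poly f x = lead_coeff f * (\<Prod>r\<in>#proots f. x - r)"
proof -
  have "poly (\<Prod>r\<in>#M. [:-r, 1:]) x = (\<Prod>r\<in>#M. x - r)" for M :: "complex multiset"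
    by (induction M) (auto simp: algebra_simps)
  then show ?thesis
    by (metis complex_poly_decompose_multiset poly_smult)
qed

text \<open>
  Reciprocity of the resultant: both sides are the product of all differences \<open>r - s\<close> of roots,
  scaled by the leading coefficients, with each of the \<open>degree f * degree g\<close> factors changing
  sign.
\<close>
lemma prod_proots_swap:
  fixes f g :: "complex poly"
  shows "lead_coeff f ^ degree g * (\<Prod>r\<in>#proots f. poly g r)
       = (-1) ^ (degree f * degree g) * (lead_coeff g ^ degree f * (\<Prod>s\<in>#proots g. poly f s))"
proof -
  have pull: "(\<Prod>r\<in>#M. k * (h r :: complex)) = k ^ size M * (\<Prod>r\<in>#M. h r)" for M :: "complex multiset" and k h
    by (simp add: prod_mset.distrib)
  have swap: "(\<Prod>r\<in>#A. \<Prod>s\<in>#B. r - s) = (-1) ^ (size A * size B) * (\<Prod>s\<in>#B. \<Prod>r\<in>#A. s - r)"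
    for A B :: "complex multiset"
  proof (induction A)
    case (add r A)
    have "(\<Prod>s\<in>#B. r - s) = (\<Prod>s\<in>#B. (-1) * (s - r))"
      by simp
    also have "\<dots> = (-1) ^ size B * (\<Prod>s\<in>#B. s - r)"
      by (rule pull)
    finally show ?case
      using add by (simp add: prod_mset.distrib power_add)
  qed auto
  show ?thesis
    unfolding poly_eq_prod_proots[of g] poly_eq_prod_proots[of f] pull
    using swap[of "proots f" "proots g"] by (simp add: size_proots_complex mult_ac)
qed

text \<open>
  For monic \<open>f\<close> the value \<open>f'(r\<^sub>i)\<close> is the product of \<open>r\<^sub>i - r\<^sub>j\<close> over
  \<open>j \<noteq> i\<close>, so every pair of roots is met twice, with opposite signs.  The factor
  \<open>(lead_coeff f)\<^sup>2\<close> on the left avoids the exponent \<open>degree f - 2\<close>, which would be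
  truncated for a linear polynomial.
\<close>
lemma poly_disc_eq_prod_pderiv:
  fixes f :: "complex poly"
  assumes "degree f \<ge> 1"
  shows "(lead_coeff f)\<^sup>2 * poly_disc f =
           (-1) ^ (degree f choose 2) * lead_coeff f ^ degree f * (\<Prod>r\<in>#proots f. poly (pderiv f) r)"
proof -
  define F :: "complex list \<Rightarrow> complex poly" where "F rs = (\<Prod>r\<leftarrow>rs. [:-r, 1:])" for rs
  define D :: "complex list \<Rightarrow> complex" where
    "D zs = (\<Prod>j<length zs. \<Prod>i<j. (zs ! i - zs ! j)\<^sup>2)" for zs
  define E :: "complex list \<Rightarrow> complex" where
    "E rs = (\<Prod>r\<leftarrow>rs. poly (pderiv (F rs)) r)" for rs
  have D_snoc: "D (zs @ [x]) = D zs * (\<Prod>y\<leftarrow>zs. (y - x)\<^sup>2)" for zs x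
  proof -
    have "(\<Prod>y\<leftarrow>zs. (y - x)\<^sup>2) = (\<Prod>i<length zs. (zs ! i - x)\<^sup>2)"
      by (induction zs rule: rev_induct) (simp_all add: nth_append mult.commute)
    moreover have "(\<Prod>j<length zs. \<Prod>i<j. ((zs @ [x]) ! i - (zs @ [x]) ! j)\<^sup>2) = D zs"
      unfolding D_def by (intro prod.cong refl) (auto simp: nth_append)
    moreover have "(\<Prod>i<length zs. ((zs @ [x]) ! i - (zs @ [x]) ! length zs)\<^sup>2)
                     = (\<Prod>i<length zs. (zs ! i - x)\<^sup>2)"
      by (intro prod.cong refl) (auto simp: nth_append)
    ultimately show ?thesis
      unfolding D_def by simp
  qed
  \<comment> \<open>Appending a root multiplies \<open>D\<close> and \<open>E\<close> by the same squares, up to sign.\<close>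
  have E_snoc: "E (rs @ [x]) = (-1) ^ length rs * (\<Prod>y\<leftarrow>rs. (y - x)\<^sup>2) * E rs" for rs x
  proof -
    have F_snoc: "F (rs @ [x]) = F rs * [:-x, 1:]"
      unfolding F_def by (simp add: mult.commute)
    have at_x: "poly (F rs) x = (\<Prod>y\<leftarrow>rs. x - y)"
      unfolding F_def by (induction rs) (auto simp: algebra_simps)
    have "poly (pderiv (F (rs @ [x]))) y = poly (F rs) y + poly (pderiv (F rs)) y * (y - x)" for y
      unfolding F_snoc pderiv_mult by (simp add: pderiv_pCons algebra_simps)
    moreover have "poly (F rs) y = 0" if "y \<in> set rs" for y
      using that unfolding F_def by (induction rs) auto
    ultimately have "E (rs @ [x]) = (\<Prod>y\<leftarrow>rs. poly (pderiv (F rs)) y * (y - x)) * (\<Prod>y\<leftarrow>rs. x - y)"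
      unfolding E_def using at_x by (simp cong: map_cong)
    also have "\<dots> = E rs * ((\<Prod>y\<leftarrow>rs. y - x) * (\<Prod>y\<leftarrow>rs. x - y))"
    proof -
      have "(\<Prod>y\<leftarrow>ys. g y * h y) = (\<Prod>y\<leftarrow>ys. g y) * (\<Prod>y\<leftarrow>ys. h y)"
        for g h :: "complex \<Rightarrow> complex" and ys
        by (induction ys) auto
      then show ?thesis unfolding E_def by simp
    qed
    also have "(\<Prod>y\<leftarrow>rs. y - x) * (\<Prod>y\<leftarrow>rs. x - y) = (-1) ^ length rs * (\<Prod>y\<leftarrow>rs. (y - x)\<^sup>2)"
      by (induction rs) (auto simp: power2_eq_square algebra_simps)
    finally show ?thesis by simp
  qed
  have DE: "E rs = (-1) ^ (length rs choose 2) * D rs" for rs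
  proof (induction rs rule: rev_induct)
    case Nil
    show ?case by (simp add: D_def E_def numeral_2_eq_2)
  next
    case (snoc x rs)
    have "Suc (length rs) choose 2 = length rs + (length rs choose 2)"
      by (simp add: numeral_2_eq_2)
    then show ?case
      unfolding E_snoc D_snoc snoc by (simp add: power_add)
  qed
  obtain rs where rs: "mset rs = proots f"
    using ex_mset by blast
  let ?a = "lead_coeff f"
  have a: "?a \<noteq> 0"
    using assms by auto
  have f: "f = smult ?a (F rs)"
    using complex_poly_decompose_multiset[of f] rs
    unfolding F_def by (metis mset_map prod_mset_prod_list)
  have len: "length rs = degree f"
    by (metis rs size_mset size_proots_complex)
  have disc: "poly_disc f = ?a ^ (2 * degree f - 2) * D rs"
    using poly_disc_eq[OF f[unfolded F_def] a] unfolding D_def len .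
  have "poly (pderiv f) r = ?a * poly (pderiv (F rs)) r" for r
    by (metis f pderiv_smult poly_smult)
  then have "(\<Prod>r\<in>#proots f. poly (pderiv f) r) = (\<Prod>r\<in>#proots f. ?a * poly (pderiv (F rs)) r)"
    by presburger
  also have "\<dots> = ?a ^ degree f * (\<Prod>r\<in>#proots f. poly (pderiv (F rs)) r)"
    by (simp add: prod_mset.distrib size_proots_complex)
  also have "(\<Prod>r\<in>#proots f. poly (pderiv (F rs)) r) = E rs"
    unfolding E_def by (metis mset_map prod_mset_prod_list rs)
  finally have "(\<Prod>r\<in>#proots f. poly (pderiv f) r) = ?a ^ degree f * E rs" .
  moreover have "?a\<^sup>2 * ?a ^ (2 * degree f - 2) = ?a ^ degree f * ?a ^ degree f"
    using assms unfolding power_add[symmetric] by (intro arg_cong[of _ _ "power ?a"]) simp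
  ultimately show ?thesis
    unfolding disc DE len by (simp add: mult_ac)
qed

section \<open>The discriminant along a pencil of polynomials\<close>

text \<open>
  The Wronskian \<open>W\<close> of \<open>P\<close> and \<open>Q\<close> is the same for all members of the pencil; at the roots of
  \<open>P + c Q\<close> it equals the derivative times \<open>Q\<close>.  Moving the product over the moving
  roots of \<open>P + c Q\<close> to the fixed roots of \<open>W\<close> exhibits the discriminant as a product of
  \<open>2 m\<close> factors linear in \<open>c\<close>.  The remaining factor is constant and nonzero because the
  resultant \<open>K\<close> of \<open>P\<close> and \<open>Q\<close> is nonzero; the roots of \<open>Q\<close> being simple ensures that \<open>Q\<close> and \<open>W\<close> have no common root, hence
  that no factor is constant in \<open>c\<close>.
\<close>
lemma disc_pencil_eq_poly:
  fixes P Q :: "complex poly"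
  assumes degP: "degree P = Suc m" and degQ: "degree Q = m" and Q0: "Q \<noteq> 0"
    and coprime: "\<And>x. poly Q x = 0 \<Longrightarrow> poly P x \<noteq> 0"
    and simple: "\<And>x. poly Q x = 0 \<Longrightarrow> poly (pderiv Q) x \<noteq> 0"
  shows "\<exists>q. q \<noteq> 0 \<and> degree q = 2 * m \<and> (\<forall>c. poly_disc (P + smult c Q) = poly q c)"
proof -
  define W where "W = pderiv P * Q - P * pderiv Q"
  define a b where "a = lead_coeff P" and "b = lead_coeff Q"
  have "P \<noteq> 0"
    using degP by auto
  then have a: "a \<noteq> 0" and b: "b \<noteq> 0"
    unfolding a_def b_def leading_coeff_0_iff using Q0 by auto
  have "coeff (pderiv P * Q) (m + m) = of_nat (Suc m) * a * b"
    using coeff_mult_degree_sum[of "pderiv P" Q] degP degQ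
    by (simp add: degree_pderiv coeff_pderiv a_def b_def)
  moreover have "coeff (P * pderiv Q) (m + m) = of_nat m * a * b"
  proof (cases m)
    case 0
    then have "pderiv Q = 0" using degQ by (simp add: pderiv_eq_0_iff)
    with 0 show ?thesis by simp
  next
    case (Suc l)
    then show ?thesis
      using coeff_mult_degree_sum[of P "pderiv Q"] degP degQ
      by (simp add: degree_pderiv coeff_pderiv a_def b_def)
  qed
  ultimately have coeffW: "coeff W (2 * m) = a * b"
    unfolding W_def mult_2 by (simp add: algebra_simps)
  have "degree (pderiv P * Q) \<le> 2 * m"
    using degree_mult_le[of "pderiv P" Q] degP degQ by (simp add: degree_pderiv)
  moreover have "degree (P * pderiv Q) \<le> 2 * m"
  proof (cases m)
    case 0
    then have "pderiv Q = 0" using degQ by (simp add: pderiv_eq_0_iff)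
    then show ?thesis by simp
  next
    case (Suc l)
    then show ?thesis
      using degree_mult_le[of P "pderiv Q"] degP degQ by (simp add: degree_pderiv)
  qed
  ultimately have "degree W \<le> 2 * m"
    unfolding W_def by (rule degree_diff_le)
  moreover have "coeff W (2 * m) \<noteq> 0"
    using coeffW a b by simp
  ultimately have degW: "degree W = 2 * m"
    by (metis le_degree order_antisym)
  have leadW: "lead_coeff W = a * b"
    unfolding degW by (rule coeffW)
  have W0: "W \<noteq> 0"
    using leadW a b by auto
  have Qw: "poly Q w \<noteq> 0" if "poly W w = 0" for w
    using that coprime[of w] simple[of w] by (auto simp: W_def)
  \<comment> \<open>The resultant of \<open>P + c Q\<close> and \<open>Q\<close>, for any \<open>c\<close>: at the roots of \<open>Q\<close> the summand \<open>c Q\<close> vanishes.\<close>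
  define K where "K = b ^ Suc m * (\<Prod>s\<in>#proots Q. poly P s)"
  have K: "K \<noteq> 0"
    using b coprime Q0 by (auto simp: K_def)
  define C where "C = (-1) ^ (Suc m choose 2) * a ^ Suc m / a\<^sup>2 * ((a * b) ^ Suc m / a ^ (2 * m) * a ^ m / K)"
  have C: "C \<noteq> 0"
    using a b K by (simp add: C_def)
  define q where "q = smult C (\<Prod>w\<in>#proots W. [:poly P w, poly Q w:])"
  have "poly_disc (P + smult c Q) = poly q c" for c
  proof -
    define f where "f = P + smult c Q"
    have degf: "degree f = Suc m" and leadf: "lead_coeff f = a"
    proof -
      have lt: "degree (smult c Q) < degree P"
        using degree_smult_le[of c Q] degP degQ by simp
      show "degree f = Suc m" "lead_coeff f = a"
        using degree_add_eq_left[OF lt] coeff_eq_0[OF lt] degP by (auto simp: f_def a_def)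
    qed
    have f0: "f \<noteq> 0" using degf by auto
    have solve: "D = A / B * E / K * F"
      if "D * G = H" "E * G = K" "B * H = A * F" "B \<noteq> 0" "K \<noteq> 0" for A B D E F G H K :: complex
    proof -
      have "B * (D * K) = A * F * E"
        unfolding that(3)[symmetric] unfolding that(1,2)[symmetric] by simp
      then show ?thesis
        using that(4,5) by (simp add: field_simps)
    qed
    have "poly (pderiv f) r * poly Q r = poly W r" if "poly f r = 0" for r
    proof -
      have "poly (pderiv f) r * poly Q r = poly W r + poly f r * poly (pderiv Q) r"
        unfolding f_def W_def by (simp add: pderiv_add pderiv_smult algebra_simps)
      with that show ?thesis by simp
    qed
    then have "(\<Prod>r\<in>#proots f. poly (pderiv f) r) * (\<Prod>r\<in>#proots f. poly Q r) = (\<Prod>r\<in>#proots f. poly W r)"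
      unfolding prod_mset.distrib[symmetric] using f0
      by (intro arg_cong[of _ _ prod_mset] image_mset_cong) auto
    moreover have resQ: "a ^ m * (\<Prod>r\<in>#proots f. poly Q r) = K"
    proof -
      have "(\<Prod>s\<in>#proots Q. poly f s) = (\<Prod>s\<in>#proots Q. poly P s)"
        using Q0 by (intro arg_cong[of _ _ prod_mset] image_mset_cong) (auto simp: f_def)
      then show ?thesis
        using prod_proots_swap[of f Q] unfolding leadf b_def[symmetric] K_def unfolding degf degQ by simp
    qed
    moreover have "a ^ (2 * m) * (\<Prod>r\<in>#proots f. poly W r) = (a * b) ^ Suc m * (\<Prod>w\<in>#proots W. poly f w)"
      using prod_proots_swap[of f W] unfolding leadf leadW unfolding degf degW by simp
    moreover have "a ^ (2 * m) \<noteq> 0"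
      using a by simp
    ultimately have "(\<Prod>r\<in>#proots f. poly (pderiv f) r)
        = (a * b) ^ Suc m / a ^ (2 * m) * a ^ m / K * (\<Prod>w\<in>#proots W. poly f w)"
      using K by (rule solve)
    moreover have "poly_disc f = (-1) ^ (Suc m choose 2) * a ^ Suc m / a\<^sup>2 * (\<Prod>r\<in>#proots f. poly (pderiv f) r)"
      using poly_disc_eq_prod_pderiv[of f] a unfolding leadf unfolding degf by (simp add: field_simps)
    moreover have "poly (\<Prod>w\<in>#M. [:poly P w, poly Q w:]) c = (\<Prod>w\<in>#M. poly f w)" for M
      by (induction M) (auto simp: f_def algebra_simps)
    ultimately show ?thesis
      unfolding f_def[symmetric] q_def C_def by simp
  qed
  moreover have "(\<Prod>w\<in>#M. [:poly P w, poly Q w:]) \<noteq> 0 \<and>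
      degree (\<Prod>w\<in>#M. [:poly P w, poly Q w:]) = size M"
    if "\<forall>w\<in>#M. poly Q w \<noteq> 0" for M
    using that by (induction M) (auto simp: degree_mult_eq simp del: mult_pCons_left)
  from this[of "proots W"] have "q \<noteq> 0 \<and> degree q = 2 * m"
    unfolding q_def using C Qw W0 degW by (simp add: size_proots_complex)
  ultimately show ?thesis by blast
qed

section \<open>Structure relations of the Jacobi polynomials\<close>

text \<open>
  The coefficient of \<open>t ^ k\<close> in \<open>(1 + v t) ^ p * (1 + u t) ^ q\<close>.  At \<open>u = (x - 1) / 2\<close>,
  \<open>v = (x + 1) / 2\<close> with \<open>p = n + a\<close> and \<open>q = n + b\<close> it is the Jacobi polynomial of
  degree \<open>n = k\<close>.  Shifting \<open>p\<close> and \<open>q\<close> independently of \<open>k\<close> turns the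
  relations between Jacobi polynomials into elementary identities for homogeneous forms in \<open>u\<close>
  and \<open>v\<close>.
\<close>
definition jacobi_form :: "'a :: field_char_0 \<Rightarrow> 'a \<Rightarrow> nat \<Rightarrow> 'a \<Rightarrow> 'a \<Rightarrow> 'a" where
  "jacobi_form p q k u v = (\<Sum>j\<le>k. (p gchoose j) * (q gchoose (k - j)) * u ^ (k - j) * v ^ j)"

lemma jacobi_form_0 [simp]: "jacobi_form p q 0 u v = 1"
  by (simp add: jacobi_form_def)

lemma jacobi_form_swap: "jacobi_form p q k u v = jacobi_form q p k v u"
  unfolding jacobi_form_def
  by (rule sum.reindex_bij_witness[of _ "\<lambda>j. k - j" "\<lambda>j. k - j"]) auto

lemma jacobi_form_Pascal_left:
  "jacobi_form p q (Suc k) u v = jacobi_form (p - 1) q (Suc k) u v + v * jacobi_form (p - 1) q k u v"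
proof -
  have "p gchoose Suc j = ((p - 1) gchoose j) + ((p - 1) gchoose Suc j)" for j
    using gbinomial_Suc_Suc[of "p - 1" j] by simp
  then show ?thesis
    unfolding jacobi_form_def sum.atMost_Suc_shift[of _ k]
    by (simp add: sum.distrib sum_distrib_left algebra_simps)
qed

lemma jacobi_form_Pascal_right:
  "jacobi_form p q (Suc k) u v = jacobi_form p (q - 1) (Suc k) u v + u * jacobi_form p (q - 1) k u v"
  using jacobi_form_Pascal_left[of q p k v u] by (simp add: jacobi_form_swap)

text \<open>
  The left-hand side is the partial derivative of the form with respect to \<open>v\<close>, and the exponent
  \<open>p\<close> drops by one when \<open>(1 + v t) ^ p\<close> is differentiated.
\<close>
lemma jacobi_form_deriv_v:
  "(\<Sum>j\<le>Suc k. of_nat j * (p gchoose j) * (q gchoose (Suc k - j)) * u ^ (Suc k - j) * v ^ (j - 1))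
     = p * jacobi_form (p - 1) q k u v"
proof -
  have "of_nat (Suc j) * (p gchoose Suc j) = p * ((p - 1) gchoose j)" for j
    by (rule gbinomial_absorption)
  then show ?thesis
    unfolding jacobi_form_def sum.atMost_Suc_shift[of _ k]
    by (simp add: sum_distrib_left mult.assoc del: of_nat_Suc)
qed

lemma jacobi_form_deriv_u:
  "(\<Sum>j\<le>Suc k. of_nat (Suc k - j) * (p gchoose j) * (q gchoose (Suc k - j)) * u ^ (Suc k - j - 1) * v ^ j)
     = q * jacobi_form p (q - 1) k u v"
  unfolding jacobi_form_swap[of p "q - 1"] jacobi_form_deriv_v[symmetric]
  by (rule sum.reindex_bij_witness[of _ "\<lambda>j. Suc k - j" "\<lambda>j. Suc k - j"]) auto

text \<open>
  Euler's identity for the homogeneous form of degree \<open>Suc k\<close>: the operator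
  \<open>u \<partial>\<^sub>u + v \<partial>\<^sub>v\<close> multiplies it by its degree.
\<close>
lemma jacobi_form_Euler:
  "of_nat (Suc k) * jacobi_form p q (Suc k) u v
     = p * v * jacobi_form (p - 1) q k u v + q * u * jacobi_form p (q - 1) k u v"
proof -
  let ?t = "\<lambda>j. (p gchoose j) * (q gchoose (Suc k - j)) * u ^ (Suc k - j) * v ^ j"
  have "v * (of_nat j * (p gchoose j) * (q gchoose (Suc k - j)) * u ^ (Suc k - j) * v ^ (j - 1))
      + u * (of_nat (Suc k - j) * (p gchoose j) * (q gchoose (Suc k - j)) * u ^ (Suc k - j - 1) * v ^ j)
      = of_nat (Suc k) * ?t j" if "j \<le> Suc k" for j
  proof -
    have "of_nat j * ?t j = v * (of_nat j * (p gchoose j) * (q gchoose (Suc k - j)) * u ^ (Suc k - j) * v ^ (j - 1))"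
      by (cases j) auto
    moreover have "of_nat (Suc k - j) * ?t j
      = u * (of_nat (Suc k - j) * (p gchoose j) * (q gchoose (Suc k - j)) * u ^ (Suc k - j - 1) * v ^ j)"
    proof -
      have shift: "of_nat i * u ^ i = u * (of_nat i * u ^ (i - 1))" for i
        by (cases i) auto
      have "of_nat (Suc k - j) * ?t j
        = (p gchoose j) * (q gchoose (Suc k - j)) * v ^ j * (of_nat (Suc k - j) * u ^ (Suc k - j))"
        by (simp only: mult_ac)
      then show ?thesis
        unfolding shift by (simp only: mult_ac)
    qed
    moreover have "of_nat j * ?t j + of_nat (Suc k - j) * ?t j = of_nat (Suc k) * ?t j"
      using that by (metis distrib_right le_add_diff_inverse of_nat_add)
    ultimately show ?thesis by (simp only: )
  qed
  then have "of_nat (Suc k) * jacobi_form p q (Suc k) u v =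
     v * (p * jacobi_form (p - 1) q k u v) + u * (q * jacobi_form p (q - 1) k u v)"
    unfolding jacobi_form_deriv_v[symmetric] jacobi_form_deriv_u[symmetric]
    unfolding jacobi_form_def sum_distrib_left sum.distrib[symmetric]
    by (intro sum.cong) auto
  then show ?thesis by (simp add: mult_ac)
qed

text \<open>
  By the two derivative lemmas the left-hand side is, for the next degree, the sum of the partial
  derivatives, hence twice the derivative of a Jacobi polynomial.  The right-hand side is thus the
  familiar fact that this derivative is a multiple of a Jacobi polynomial with both parameters raised
  by one.
\<close>
lemma jacobi_form_contiguous:
  "p * jacobi_form (p - 1) q k u v + q * jacobi_form p (q - 1) k u v
     = (p + q - of_nat k) * jacobi_form p q k u v"
proof -
  have "p * (((p - 1) gchoose j) * (q gchoose (k - j)) * u ^ (k - j) * v ^ j)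
      + q * ((p gchoose j) * ((q - 1) gchoose (k - j)) * u ^ (k - j) * v ^ j)
      = (p + q - of_nat k) * ((p gchoose j) * (q gchoose (k - j)) * u ^ (k - j) * v ^ j)" (is "?L = ?R")
    if "j \<le> k" for j
  proof -
    have k: "(of_nat k :: 'a) = of_nat j + of_nat (k - j)"
      using that by (simp flip: of_nat_add)
    have "?L = (p * ((p - 1) gchoose j)) * (q gchoose (k - j)) * u ^ (k - j) * v ^ j
      + (q * ((q - 1) gchoose (k - j))) * (p gchoose j) * u ^ (k - j) * v ^ j"
      by (simp add: mult_ac)
    also have "\<dots> = ?R"
      unfolding gbinomial_absorb_comp[symmetric] k by (simp add: algebra_simps)
    finally show ?thesis .
  qed
  then show ?thesis
    unfolding jacobi_form_def sum_distrib_left sum.distrib[symmetric]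
    by (intro sum.cong) auto
qed

lemma poly_jacobi_poly:
  "poly (jacobi_poly a b n) x = jacobi_form (of_nat n + a) (of_nat n + b) n ((x - 1) / 2) ((x + 1) / 2)"
proof -
  have "poly [:-1/2, 1/2:] x = (x - 1) / 2" "poly [:1/2, 1/2:] x = (x + 1) / 2"
    by (auto simp: field_simps)
  then show ?thesis
    unfolding jacobi_poly_def jacobi_form_def
    by (simp only: poly_sum poly_smult poly_mult poly_power mult.assoc)
qed

text \<open>
  Both \<open>u\<close> and \<open>v\<close> have derivative \<open>1 / 2\<close> with respect to \<open>x\<close>.
\<close>
lemma poly_pderiv_jacobi_poly:
  fixes a b x :: "'a :: field_char_0" and k :: nat
  defines "u \<equiv> (x - 1) / 2" and "v \<equiv> (x + 1) / 2"
    and "p \<equiv> of_nat (Suc k) + a" and "q \<equiv> of_nat (Suc k) + b"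
  shows "2 * poly (pderiv (jacobi_poly a b (Suc k))) x
           = p * jacobi_form (p - 1) q k u v + q * jacobi_form p (q - 1) k u v"
proof -
  have ev: "poly [:-1/2, 1/2:] x = u" "poly [:1/2, 1/2:] x = v"
    by (auto simp: field_simps u_def v_def)
  have d: "pderiv [:-1/2, 1/2 :: 'a:] = [:1/2:]" "pderiv [:1/2, 1/2 :: 'a:] = [:1/2:]"
    by (auto simp: pderiv_pCons)
  have pd: "pderiv (jacobi_poly a b (Suc k)) =
    (\<Sum>j\<le>Suc k. smult ((p gchoose j) * (q gchoose (Suc k - j)))
              (pderiv ([:-1/2, 1/2:] ^ (Suc k - j) * [:1/2, 1/2:] ^ j)))"
    unfolding jacobi_poly_def p_def q_def higher_pderiv_sum[of 1, simplified] by (simp add: pderiv_smult)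
  have "2 * poly (pderiv ([:-1/2, 1/2:] ^ i * [:1/2, 1/2:] ^ j)) x
      = of_nat j * u ^ i * v ^ (j - 1) + of_nat i * u ^ (i - 1) * v ^ j" for i j
    unfolding pderiv_mult pderiv_power d
    by (simp only: poly_add poly_mult poly_smult poly_power ev) (simp add: algebra_simps)
  then have "(p gchoose j) * (q gchoose (Suc k - j)) *
        (2 * poly (pderiv ([:-1/2, 1/2:] ^ (Suc k - j) * [:1/2, 1/2:] ^ j)) x) =
      of_nat j * (p gchoose j) * (q gchoose (Suc k - j)) * u ^ (Suc k - j) * v ^ (j - 1)
      + of_nat (Suc k - j) * (p gchoose j) * (q gchoose (Suc k - j)) * u ^ (Suc k - j - 1) * v ^ j" for j
    by (simp add: algebra_simps)
  then have "2 * poly (pderiv (jacobi_poly a b (Suc k))) x = 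
     (\<Sum>j\<le>Suc k. of_nat j * (p gchoose j) * (q gchoose (Suc k - j)) * u ^ (Suc k - j) * v ^ (j - 1)
      + of_nat (Suc k - j) * (p gchoose j) * (q gchoose (Suc k - j)) * u ^ (Suc k - j - 1) * v ^ j)"
    unfolding pd poly_sum sum_distrib_left poly_smult
    by (intro sum.cong refl) (metis (no_types, lifting) mult.left_commute)
  then show ?thesis
    unfolding sum.distrib jacobi_form_deriv_u jacobi_form_deriv_v .
qed

text \<open>
  The two structure relations.  With \<open>n = Suc k\<close>, let \<open>F\<close> and \<open>E\<close> be the forms with
  exponents \<open>p - 1\<close>, \<open>q - 1\<close> and degrees \<open>n - 1\<close>, \<open>n - 2\<close>.  The Pascal,
  Euler and contiguity identities write both Jacobi polynomials and their derivatives as linear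
  combinations of \<open>F\<close> and \<open>E\<close> with coefficients polynomial in \<open>u\<close> and
  \<open>v\<close>; since \<open>1 - x\<^sup>2 = -4 u v\<close>, each relation is then an identity of polynomials after
  comparing the coefficients of \<open>F\<close> and \<open>E\<close>.
\<close>
lemma
  fixes a b x :: "'a :: field_char_0" and k :: nat
  defines "N \<equiv> 2 * of_nat (Suc k) + a + b"
  defines "P \<equiv> jacobi_poly a b (Suc k)" and "Q \<equiv> jacobi_poly a b k"
  shows jacobi_structure_lowering:
      "N * (1 - x\<^sup>2) * poly (pderiv P) x
         = of_nat (Suc k) * (a - b - N * x) * poly P x
           + 2 * (of_nat (Suc k) + a) * (of_nat (Suc k) + b) * poly Q x" (is ?lowering)
    and jacobi_structure_raising:
      "N * (1 - x\<^sup>2) * poly (pderiv Q) x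
         = (of_nat (Suc k) + a + b) * (N * x + a - b) * poly Q x
           - 2 * of_nat (Suc k) * (of_nat (Suc k) + a + b) * poly P x" (is ?raising)
proof -
  define u v where "u = (x - 1) / 2" and "v = (x + 1) / 2"
  define p q where "p = of_nat (Suc k) + a" and "q = of_nat (Suc k) + b"
  define F where "F = jacobi_form (p - 1) (q - 1) k u v"
  \<comment> \<open>There is no form of degree \<open>-1\<close>; the value \<open>0\<close> keeps the identities below valid for \<open>k = 0\<close>.\<close>
  define E where "E = (if k = 0 then 0 else jacobi_form (p - 1) (q - 1) (k - 1) u v)"
  have x: "x = 2 * u + 1" and v: "v = u + 1"
    by (auto simp: u_def v_def field_simps)
  have N: "N = p + q"
    unfolding N_def p_def q_def by simp
  have ab: "a - b = p - q" and nab: "of_nat (Suc k) + a + b = p + q - of_nat (Suc k)"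
    unfolding p_def q_def by auto
  have left: "jacobi_form (p - 1) q k u v = F + u * E"
    unfolding F_def E_def using jacobi_form_Pascal_right[of "p - 1" q "k - 1" u v] by (cases k) auto
  have right: "jacobi_form p (q - 1) k u v = F + v * E"
    unfolding F_def E_def using jacobi_form_Pascal_left[of p "q - 1" "k - 1" u v] by (cases k) auto
  have P: "of_nat (Suc k) * poly P x = (p * v + q * u) * F + N * u * v * E"
    unfolding P_def poly_jacobi_poly u_def[symmetric] v_def[symmetric] p_def[symmetric] q_def[symmetric]
      jacobi_form_Euler left right N by (simp add: algebra_simps)
  have Q: "poly Q x = F"
    unfolding Q_def poly_jacobi_poly u_def[symmetric] v_def[symmetric] F_def p_def q_def by simp
  have dP: "2 * poly (pderiv P) x = N * F + (p * u + q * v) * E"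
    unfolding P_def poly_pderiv_jacobi_poly u_def[symmetric] v_def[symmetric] p_def[symmetric]
      q_def[symmetric] left right N by (simp add: algebra_simps)
  have dQ: "2 * poly (pderiv Q) x = (N - of_nat (Suc k)) * E"
  proof (cases k)
    case 0
    then have "Q = 1"
      by (simp add: Q_def jacobi_poly_def)
    with 0 show ?thesis by (simp add: E_def pderiv_1)
  next
    case (Suc l)
    have "2 * poly (pderiv Q) x = (p - 1) * jacobi_form (p - 1 - 1) (q - 1) l u v + (q - 1) * jacobi_form (p - 1) (q - 1 - 1) l u v"
      unfolding Q_def Suc poly_pderiv_jacobi_poly u_def[symmetric] v_def[symmetric]
      by (simp add: p_def q_def Suc algebra_simps)
    then show ?thesis
      unfolding jacobi_form_contiguous by (simp add: E_def Suc N algebra_simps)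
  qed
  have x2: "1 - x\<^sup>2 = - 4 * u * v"
    unfolding x v by (simp add: power2_eq_square algebra_simps)
  have "N * (1 - x\<^sup>2) * poly (pderiv P) x = - 2 * N * u * v * (2 * poly (pderiv P) x)"
    unfolding x2 by simp
  also have "\<dots> = - 2 * N * u * v * (N * F + (p * u + q * v) * E)"
    unfolding dP ..
  also have "\<dots> = (p - q - N * x) * ((p * v + q * u) * F + N * u * v * E) + 2 * p * q * F"
    unfolding N x v by (simp add: algebra_simps)
  also have "\<dots> = (p - q - N * x) * (of_nat (Suc k) * poly P x) + 2 * p * q * poly Q x"
    unfolding P Q ..
  finally show ?lowering
    unfolding ab[symmetric] unfolding p_def q_def by (simp only: mult_ac)
  have "N * (1 - x\<^sup>2) * poly (pderiv Q) x = - 2 * N * u * v * (2 * poly (pderiv Q) x)"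
    unfolding x2 by simp
  also have "\<dots> = - 2 * N * u * v * ((N - of_nat (Suc k)) * E)"
    unfolding dQ ..
  also have "\<dots> = (p + q - of_nat (Suc k)) * (N * x + (p - q)) * F
      - 2 * (p + q - of_nat (Suc k)) * ((p * v + q * u) * F + N * u * v * E)"
    unfolding N x v by (simp add: algebra_simps)
  also have "\<dots> = (p + q - of_nat (Suc k)) * (N * x + (p - q)) * poly Q x
      - 2 * (p + q - of_nat (Suc k)) * (of_nat (Suc k) * poly P x)"
    unfolding P Q ..
  finally show ?raising
    unfolding ab[symmetric] nab[symmetric] by (simp only: mult_ac add_diff_eq)
qed

lemma jacobi_poly_at_1: "poly (jacobi_poly a b n) 1 = (of_nat n + a) gchoose n"
proof -
  have "jacobi_form p q n 0 1 = (\<Sum>j\<in>{n}. (p gchoose j) * (q gchoose (n - j)) * 0 ^ (n - j))" for p q :: 'a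
    unfolding jacobi_form_def by (rule sum.mono_neutral_cong_right) auto
  then show ?thesis by (simp add: poly_jacobi_poly)
qed

lemma jacobi_poly_at_minus_1: "poly (jacobi_poly a b n) (-1) = (-1) ^ n * ((of_nat n + b) gchoose n)"
proof -
  have "jacobi_form p q n (-1) 0 = (\<Sum>j\<in>{0}. (p gchoose j) * (q gchoose (n - j)) * (-1) ^ (n - j))" for p q :: 'a
    unfolding jacobi_form_def by (rule sum.mono_neutral_cong_right) auto
  then show ?thesis by (simp add: poly_jacobi_poly)
qed

text \<open>
  Every summand has degree \<open>n\<close> and leading coefficient \<open>1 / 2 ^ n\<close> times a product of two
  binomials, so the top coefficient is a Vandermonde convolution.
\<close>
lemma
  fixes a b :: "'a :: field_char_0"
  shows degree_jacobi_poly_le: "degree (jacobi_poly a b n) \<le> n"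
    and coeff_jacobi_poly: "coeff (jacobi_poly a b n) n = ((2 * of_nat n + a + b) gchoose n) / 2 ^ n"
proof -
  have deg: "degree ([:-1/2, 1/2 :: 'a:] ^ (n - j) * [:1/2, 1/2:] ^ j) = n"
    and lead: "coeff ([:-1/2, 1/2 :: 'a:] ^ (n - j) * [:1/2, 1/2:] ^ j) n = 1 / 2 ^ n" if "j \<le> n" for j
  proof -
    show *: "degree ([:-1/2, 1/2 :: 'a:] ^ (n - j) * [:1/2, 1/2:] ^ j) = n"
      using that by (simp add: degree_mult_eq degree_power_eq)
    have "lead_coeff ([:-1/2, 1/2 :: 'a:] ^ (n - j) * [:1/2, 1/2:] ^ j) = (1/2) ^ (n - j) * (1/2) ^ j"
      unfolding lead_coeff_mult lead_coeff_power by simp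
    also have "\<dots> = 1 / 2 ^ n"
      using that by (simp flip: power_add add: power_one_over)
    finally show "coeff ([:-1/2, 1/2 :: 'a:] ^ (n - j) * [:1/2, 1/2:] ^ j) n = 1 / 2 ^ n"
      unfolding * .
  qed
  show "degree (jacobi_poly a b n) \<le> n"
    unfolding jacobi_poly_def using deg
    by (intro degree_sum_le) (auto intro: order_trans[OF degree_smult_le])
  have "coeff (jacobi_poly a b n) n = (\<Sum>j\<le>n. ((of_nat n + a) gchoose j) * ((of_nat n + b) gchoose (n - j))) / 2 ^ n"
    unfolding jacobi_poly_def coeff_sum coeff_smult sum_divide_distrib
    using lead by (intro sum.cong) auto
  also have "(\<Sum>j\<le>n. ((of_nat n + a) gchoose j) * ((of_nat n + b) gchoose (n - j))) = ((of_nat n + a) + (of_nat n + b)) gchoose n"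
    using gbinomial_Vandermonde[of "of_nat n + a" "of_nat n + b" n] by (simp add: atMost_atLeast0)
  finally show "coeff (jacobi_poly a b n) n = ((2 * of_nat n + a + b) gchoose n) / 2 ^ n"
    by (simp add: algebra_simps)
qed

section \<open>Resultants of consecutive Jacobi polynomials\<close>

text \<open>
  These are the factors of the values of \<open>P\<^sub>n\<close> at \<open>\<plusminus>1\<close> and of its leading
  coefficient; for real \<open>a, b > -1\<close> they are positive.  Their nonvanishing says that \<open>\<plusminus>1\<close> are not roots of any \<open>P\<^sub>n\<close>, that \<open>P\<^sub>n\<close> has degree exactly
  \<open>n\<close>, and that the divisions below are legitimate.
\<close>
locale regular_jacobi =
  fixes a b :: complex
  assumes a_regular: "of_nat (Suc k) + a \<noteq> 0"
    and b_regular: "of_nat (Suc k) + b \<noteq> 0"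
    and ab_regular: "of_nat (Suc (Suc k)) + a + b \<noteq> 0"
begin

abbreviation "P \<equiv> jacobi_poly a b"
abbreviation "N n \<equiv> 2 * of_nat n + a + b"
abbreviation "l n \<equiv> lead_coeff (P n)"

lemma N_nonzero: "N (Suc k) \<noteq> 0"
proof -
  have "N (Suc k) = of_nat (Suc (Suc (2 * k))) + a + b"
    by simp
  then show ?thesis
    using ab_regular[of "2 * k"] by metis
qed

lemma gbinomial_shift_nonzero:
  fixes d :: complex
  assumes "\<And>k. of_nat (Suc k) + d \<noteq> 0"
  shows "(of_nat n + d) gchoose n \<noteq> 0"
proof -
  have "of_nat n + d - of_nat i \<noteq> 0" if "i < n" for i
    using assms[of "n - Suc i"] that by (simp add: of_nat_diff algebra_simps)
  then show ?thesis
    by (auto simp: gbinomial_prod_rev)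
qed

lemma P_at_1: "poly (P n) 1 \<noteq> 0" and P_at_minus_1: "poly (P n) (-1) \<noteq> 0"
  using gbinomial_shift_nonzero[of a n] gbinomial_shift_nonzero[of b n] a_regular b_regular
  by (auto simp: jacobi_poly_at_1 jacobi_poly_at_minus_1)

lemma coeff_P_nonzero: "coeff (P n) n \<noteq> 0"
proof -
  have "N n - of_nat i \<noteq> 0" if "i < n" for i
  proof -
    have "(2::complex) * of_nat n = of_nat i + of_nat (2 * n - i)"
      using that by (simp flip: of_nat_add)
    moreover have "2 * n - i = Suc (Suc (2 * n - i - 2))"
      using that by simp
    ultimately have "N n - of_nat i = of_nat (Suc (Suc (2 * n - i - 2))) + a + b"
      by (metis add_diff_cancel_left' add.assoc)
    then show ?thesis
      using ab_regular by metis
  qed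
  then show ?thesis
    by (auto simp: coeff_jacobi_poly gbinomial_prod_rev)
qed

lemma degree_P [simp]: "degree (P n) = n"
  using degree_jacobi_poly_le[of a b n] le_degree[OF coeff_P_nonzero] by (rule order_antisym)

lemma l_eq: "l n = (N n gchoose n) / 2 ^ n"
  by (simp add: coeff_jacobi_poly)

lemma P_nonzero [simp]: "P n \<noteq> 0"
  by (metis coeff_0 coeff_P_nonzero)

lemma P_0 [simp]: "P 0 = 1"
  by (simp add: jacobi_poly_def)

lemma raising_at_root:
  assumes "poly (P k) s = 0"
  shows "N (Suc k) * (1 - s\<^sup>2) * poly (pderiv (P k)) s
           = - 2 * of_nat (Suc k) * (of_nat (Suc k) + a + b) * poly (P (Suc k)) s"
  using jacobi_structure_raising[of k a b s] assms by (simp del: of_nat_Suc)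

lemma lowering_at_root:
  assumes "poly (P (Suc k)) s = 0"
  shows "N (Suc k) * (1 - s\<^sup>2) * poly (pderiv (P (Suc k))) s
           = 2 * (of_nat (Suc k) + a) * (of_nat (Suc k) + b) * poly (P k) s"
  using jacobi_structure_lowering[of k a b s] assms by (simp del: of_nat_Suc)

text \<open>
  Up to sign, \<open>\<gamma> n\<close> is the coefficient of \<open>P\<^sub>n\<^sub>-\<^sub>1\<close> in the three-term recurrence for
  \<open>P\<^sub>n\<^sub>+\<^sub>1\<close>.  The recurrence is needed only at the roots of \<open>P\<^sub>n\<close>, and there it follows by
  eliminating \<open>(1 - s\<^sup>2) P\<^sub>n'(s)\<close> from the two structure relations.
\<close>
definition \<gamma> :: "nat \<Rightarrow> complex" where
  "\<gamma> n = (of_nat n + a) * (of_nat n + b) * N (Suc n)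
           / (N n * of_nat (Suc n) * (of_nat (Suc n) + a + b))"

lemma recurrence_at_root:
  assumes "poly (P (Suc k)) s = 0"
  shows "poly (P (Suc (Suc k))) s = - \<gamma> (Suc k) * poly (P k) s"
proof -
  let ?n = "Suc k"
  define D where "D = (1 - s\<^sup>2) * poly (pderiv (P ?n)) s"
  have up: "N (Suc ?n) * D = - 2 * of_nat (Suc ?n) * (of_nat (Suc ?n) + a + b) * poly (P (Suc ?n)) s"
    using raising_at_root[OF assms] unfolding D_def by (simp only: mult.assoc)
  have down: "N ?n * D = 2 * (of_nat ?n + a) * (of_nat ?n + b) * poly (P k) s"
    using lowering_at_root[OF assms] unfolding D_def by (simp only: mult.assoc)
  have nz: "N ?n \<noteq> 0" "of_nat (Suc ?n) + a + b \<noteq> 0" "of_nat (Suc ?n) \<noteq> (0::complex)"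
    using N_nonzero ab_regular of_nat_neq_0 by blast+
  have alg: "Y = - (p * q * M / (N' * t * w)) * Z"
    if "M * D = - 2 * t * w * Y" "N' * D = 2 * p * q * Z" "N' \<noteq> 0" "w \<noteq> 0" "t \<noteq> 0"
    for M N' p q t w Y Z :: complex
  proof -
    have "2 * t * w * Y = - (M * D)"
      using that(1) by simp
    then have "N' * (2 * t * w * Y) = - (M * (N' * D))"
      by simp
    then have "N' * (2 * t * w * Y) = - (M * (2 * p * q * Z))"
      unfolding that(2) .
    then show ?thesis using that(3-5) by (simp add: field_simps)
  qed
  show ?thesis
    unfolding \<gamma>_def by (rule alg[OF up down nz])
qed

text \<open>
  By the recurrence a common root of two consecutive polynomials would also be a root of all earlier
  ones, but \<open>P\<^sub>0 = 1\<close>.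
\<close>
lemma no_common_root: "poly (P k) s = 0 \<Longrightarrow> poly (P (Suc k)) s \<noteq> 0"
proof (induction k)
  case (Suc k)
  show ?case
  proof
    assume "poly (P (Suc (Suc k))) s = 0"
    then have "\<gamma> (Suc k) = 0 \<or> poly (P k) s = 0"
      using recurrence_at_root[OF Suc.prems] by simp
    moreover have "\<gamma> (Suc k) \<noteq> 0"
      using a_regular[of k] b_regular[of k] N_nonzero[of k] N_nonzero[of "Suc k"] ab_regular[of k]
      unfolding \<gamma>_def by (simp del: of_nat_Suc)
    ultimately show False
      using Suc by blast
  qed
qed simp

text \<open>
  By the raising relation a multiple root of \<open>P\<^sub>k\<close> would be a root of \<open>P\<^sub>k\<^sub>+\<^sub>1\<close>.
\<close>
lemma simple_roots:
  assumes "poly (P k) s = 0"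
  shows "poly (pderiv (P k)) s \<noteq> 0"
proof
  assume "poly (pderiv (P k)) s = 0"
  then have "of_nat (Suc k) * (of_nat (Suc k) + a + b) * poly (P (Suc k)) s = 0"
    using raising_at_root[OF assms] by (simp del: of_nat_Suc)
  moreover obtain j where "k = Suc j"
    using assms by (cases k) auto
  then have "of_nat (Suc k) + a + b \<noteq> 0"
    using ab_regular by blast
  ultimately show False
    using no_common_root[OF assms] of_nat_neq_0[of k, where ?'a = complex] by simp
qed

text \<open>
  The resultant of \<open>P\<^sub>k\<close> and \<open>P\<^sub>k\<^sub>+\<^sub>1\<close>.  The order of the two does not matter, as the
  product \<open>k (k + 1)\<close> of their degrees is even.
\<close>
definition \<rho> :: "nat \<Rightarrow> complex" where
  "\<rho> k = l k ^ Suc k * (\<Prod>s\<in>#proots (P k). poly (P (Suc k)) s)"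

lemma \<rho>_0: "\<rho> 0 = 1"
  by (simp add: \<rho>_def)

text \<open>
  At the roots of \<open>P\<^sub>k\<^sub>+\<^sub>1\<close> the recurrence replaces \<open>P\<^sub>k\<^sub>+\<^sub>2\<close> by a multiple of
  \<open>P\<^sub>k\<close>, and reciprocity then turns the product over the roots of \<open>P\<^sub>k\<^sub>+\<^sub>1\<close> into one over
  the roots of \<open>P\<^sub>k\<close>.
\<close>
lemma \<rho>_Suc: "\<rho> (Suc k) = (l (Suc k))\<^sup>2 * (- \<gamma> (Suc k)) ^ Suc k * \<rho> k"
proof -
  have "(\<Prod>s\<in>#proots (P (Suc k)). poly (P (Suc (Suc k))) s)
      = (\<Prod>s\<in>#proots (P (Suc k)). - \<gamma> (Suc k) * poly (P k) s)"
    by (intro arg_cong[of _ _ prod_mset] image_mset_cong) (simp add: recurrence_at_root)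
  also have "\<dots> = (- \<gamma> (Suc k)) ^ Suc k * (\<Prod>s\<in>#proots (P (Suc k)). poly (P k) s)"
    unfolding prod_mset.distrib by (simp add: size_proots_complex)
  finally have "\<rho> (Suc k) = (l (Suc k))\<^sup>2 * (- \<gamma> (Suc k)) ^ Suc k
      * (l (Suc k) ^ k * (\<Prod>s\<in>#proots (P (Suc k)). poly (P k) s))"
    unfolding \<rho>_def by (simp add: power2_eq_square mult_ac)
  also have "l (Suc k) ^ k * (\<Prod>s\<in>#proots (P (Suc k)). poly (P k) s) = \<rho> k"
    using prod_proots_swap[of "P (Suc k)" "P k"] unfolding \<rho>_def by simp
  finally show ?thesis .
qed

section \<open>The constant factor\<close>

definition disc_const :: "nat \<Rightarrow> complex" where
  "disc_const n = N n ^ (2 * n - 1) / 2 ^ (n * (n - 1))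
     * (\<Prod>k=1..n. of_nat k powi (int k - 2 * int n + 3))
     * (\<Prod>k=1..n-1. (of_nat k + a) ^ (k - 1) * (of_nat k + b) ^ (k - 1)
                      * (of_nat n + of_nat k + a + b) ^ (n - k - 1))"

text \<open>
  The quotient of consecutive constants, cleared of denominators.  Each factor \<open>n + k + a + b\<close>
  depends on \<open>n\<close> and \<open>k\<close> only through \<open>n + k\<close>, so in passing from \<open>n\<close> to
  \<open>Suc n\<close> the factors stay the same while their exponents grow by two.  The extra squares make
  up the square of the numerator of the leading coefficient \<open>l n\<close>; the two ends of the range of
  \<open>n + k\<close> leave one power of \<open>N n\<close> and the \<open>n\<close>-th power of
  \<open>n + 1 + a + b\<close>.
\<close>
lemma disc_const_Suc:
  assumes "n \<ge> 1"
  shows "disc_const (Suc n) * (N n ^ (2 * n) * (of_nat (Suc n) + a + b) ^ n * of_nat (Suc n) ^ n)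
     = disc_const n * (l n)\<^sup>2 * N (Suc n) ^ (2 * n + 1) * (of_nat (Suc n))\<^sup>2
         * ((of_nat n + a) * (of_nat n + b)) ^ (n - 1)"
proof -
  \<comment> \<open>The powers of \<open>k\<close>, the factors with one parameter, and the factors with both.\<close>
  define T where "T m = (\<Prod>k=1..m. of_nat k powi (int k - 2 * int m + 3) :: complex)" for m
  define U where "U m = (\<Prod>k=1..m-1. (of_nat k + a) ^ (k - 1) * (of_nat k + b) ^ (k - 1))" for m
  define w where "w k = of_nat k + a + b" for k
  define V where "V m = (\<Prod>k=1..m-1. w (m + k) ^ (m - k - 1))" for m
  have const: "disc_const m = N m ^ (2 * m - 1) / 2 ^ (m * (m - 1)) * T m * (U m * V m)" for m
    unfolding disc_const_def T_def U_def V_def w_def prod.distrib[symmetric] by (simp add: add.assoc)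
  have T: "T (Suc n) * of_nat (Suc n) ^ n * (fact n)\<^sup>2 = T n * (of_nat (Suc n))\<^sup>2"
  proof -
    have "T (Suc n) = (\<Prod>k=1..n. of_nat k powi (int k - 2 * int n + 3) / (of_nat k)\<^sup>2)
        * of_nat (Suc n) powi (2 - int n)"
    proof -
      have last: "prod h {1..Suc n} = prod h {1..n} * h (Suc n)" for h :: "nat \<Rightarrow> complex"
        by simp
      have "(\<Prod>k=1..n. of_nat k powi (int k - 2 * int (Suc n) + 3))
          = (\<Prod>k=1..n. of_nat k powi (int k - 2 * int n + 3) / (of_nat k :: complex)\<^sup>2)"
      proof (rule prod.cong)
        fix k assume k: "k \<in> {1..n}"
        have shift: "int k - 2 * int (Suc n) + 3 = int k - 2 * int n + 3 - 2"
          by simp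
        show "of_nat k powi (int k - 2 * int (Suc n) + 3)
            = of_nat k powi (int k - 2 * int n + 3) / (of_nat k :: complex)\<^sup>2"
          unfolding shift using k by (subst power_int_diff) auto
      qed simp
      moreover have "int (Suc n) - 2 * int (Suc n) + 3 = 2 - int n"
        by simp
      ultimately show ?thesis
        unfolding T_def last by (simp only:)
    qed
    also have "(\<Prod>k=1..n. of_nat k powi (int k - 2 * int n + 3) / (of_nat k)\<^sup>2) = T n / (fact n)\<^sup>2"
      unfolding T_def prod_dividef by (simp add: fact_prod power2_eq_square prod.distrib)
    also have "of_nat (Suc n) powi (2 - int n) = (of_nat (Suc n))\<^sup>2 / (of_nat (Suc n) ^ n :: complex)"
      using of_nat_neq_0[of n] by (simp add: power_int_diff del: of_nat_Suc)
    finally show ?thesis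
      using of_nat_neq_0[of n, where ?'a = complex] by (simp add: field_simps del: of_nat_Suc)
  qed
  have U: "U (Suc n) = U n * ((of_nat n + a) * (of_nat n + b)) ^ (n - 1)"
    using assms unfolding U_def by (cases n) (simp_all add: power_mult_distrib)
  have l: "(2 ^ n * fact n * l n) = (\<Prod>k=1..n. w (n + k))"
  proof -
    have "2 ^ n * fact n * l n = fact n * (N n gchoose n)"
      unfolding l_eq by simp
    also have "\<dots> = (\<Prod>i<n. N n - of_nat i)"
      by (simp add: gbinomial_prod_rev atLeast0LessThan)
    also have "\<dots> = (\<Prod>k=1..n. w (n + k))"
      by (rule prod.reindex_bij_witness[of _ "\<lambda>k. n - k" "\<lambda>i. n - i"])
        (auto simp: w_def of_nat_diff)
    finally show ?thesis .
  qed
  have V: "V (Suc n) * N n * w (Suc n) ^ n = V n * (2 ^ n * fact n * l n)\<^sup>2"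
  proof -
    have 1: "V (Suc n) * w (Suc n) ^ n = (\<Prod>k=1..n. w (n + k) ^ (n + 1 - k))"
    proof -
      have "(\<Prod>k=1..n. w (n + k) ^ (n + 1 - k)) = (\<Prod>k=1..Suc n. w (n + k) ^ (n + 1 - k))"
        by simp
      also have "\<dots> = w (n + 1) ^ n * (\<Prod>k=2..Suc n. w (n + k) ^ (n + 1 - k))"
        by (subst prod.atLeast_Suc_atMost) (auto simp: numeral_2_eq_2)
      also have "(\<Prod>k=2..Suc n. w (n + k) ^ (n + 1 - k)) = V (Suc n)"
        unfolding V_def
        by (rule prod.reindex_bij_witness[of _ Suc "\<lambda>k. k - 1"]) auto
      finally show ?thesis by simp
    qed
    have 2: "(\<Prod>k=1..n. w (n + k) ^ (n + 1 - k)) = w (n + n) * (\<Prod>k=1..n-1. w (n + k) ^ (n + 1 - k))"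
      using assms by (cases n) (auto simp: mult.commute)
    have 3: "(\<Prod>k=1..n. w (n + k)) = w (n + n) * (\<Prod>k=1..n-1. w (n + k))"
      using assms by (cases n) (auto simp: mult.commute)
    have 4: "V n * (\<Prod>k=1..n-1. w (n + k))\<^sup>2 = (\<Prod>k=1..n-1. w (n + k) ^ (n + 1 - k))"
    proof -
      have "w (n + k) ^ (n - k - 1) * (w (n + k))\<^sup>2 = w (n + k) ^ (n + 1 - k)" if "k \<in> {1..n-1}" for k
      proof -
        have "n + 1 - k = n - k - 1 + 2"
          using that assms by auto
        then show ?thesis
          by (simp only: power_add)
      qed
      then show ?thesis
        unfolding V_def prod_power_distrib prod.distrib[symmetric] by (rule prod.cong[OF refl])
    qed
    have N: "N n = w (n + n)"
      by (simp add: w_def)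
    have "V (Suc n) * N n * w (Suc n) ^ n = w (n + n) * (V (Suc n) * w (Suc n) ^ n)"
      unfolding N by (simp only: mult_ac)
    also have "\<dots> = V n * (w (n + n) * (\<Prod>k=1..n-1. w (n + k)))\<^sup>2"
      unfolding 1 2 4[symmetric] by (simp add: power2_eq_square mult_ac)
    finally show ?thesis unfolding l 3 .
  qed
  have pow: "N n ^ (2 * n) = N n ^ (2 * n - 1) * N n"
    using assms by (cases n) (simp_all add: mult_ac)
  have two: "(2::complex) ^ (Suc n * (Suc n - 1)) = 2 ^ (n * (n - 1)) * (2 ^ n)\<^sup>2"
  proof -
    have "Suc n * (Suc n - 1) = n * (n - 1) + n * 2"
      by (cases n) auto
    then show ?thesis
      by (simp only: power_mult power_add)
  qed
  \<comment> \<open>The claim in terms of independent quantities: only the two identities \<open>V\<close> and \<open>T\<close> enter.\<close>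
  have alg: "NN / (e * ee\<^sup>2) * T' * (U * uu * V') * (N0 * N1 * ww * tt) = N0 / e * T0 * (U * V0) * L\<^sup>2 * NN * t2 * uu"
    if "V' * N1 * ww = V0 * (ee * F * L)\<^sup>2" "T' * tt * F\<^sup>2 = T0 * t2" "e \<noteq> 0" "ee \<noteq> 0" "F \<noteq> 0"
    for NN e ee T' U uu V' N0 N1 ww tt T0 V0 L t2 F :: complex
  proof -
    have "NN / (e * ee\<^sup>2) * T' * (U * uu * V') * (N0 * N1 * ww * tt)
      = NN / (e * ee\<^sup>2) * N0 * U * uu * T' * tt * (V' * N1 * ww)"
      by (simp only: mult_ac)
    also have "\<dots> = NN * N0 / e * U * uu * V0 * L\<^sup>2 * (T' * tt * F\<^sup>2)"
      unfolding that(1) using that(3-5) by (simp add: field_simps)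
    also have "\<dots> = N0 / e * T0 * (U * V0) * L\<^sup>2 * NN * t2 * uu"
      unfolding that(2) by (simp only: times_divide_eq_left times_divide_eq_right mult_ac)
    finally show ?thesis .
  qed
  have two_Suc: "2 * Suc n - 1 = 2 * n + 1" by simp
  show ?thesis
    unfolding const U two two_Suc pow w_def[symmetric]
    by (rule alg[OF V T]) simp_all
qed

text \<open>
  The constant collects the resultant of \<open>P\<^sub>k\<^sub>+\<^sub>1\<close> and \<open>P\<^sub>k\<close>, the powers of
  \<open>N (Suc k)\<close> from the structure relations, and the constant factors of the values of the
  quasi-Jacobi polynomial at \<open>\<plusminus>1\<close>.  By induction it suffices to compare the quotient of
  consecutive constants with \<open>\<rho>_Suc\<close>.
\<close>
lemma disc_const_eq_\<rho>:
  "disc_const (Suc k) * (((of_nat k + a) gchoose k) * ((of_nat k + b) gchoose k))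
     = (of_nat (Suc k))\<^sup>2 * N (Suc k) ^ Suc k * (-1) ^ (Suc k choose 2) * \<rho> k"
proof (induction k)
  case 0
  show ?case
    by (simp add: disc_const_def \<rho>_0 numeral_2_eq_2)
next
  case (Suc k)
  define n where "n = Suc k"
  define t p q w where "t = (of_nat (Suc n) :: complex)" and "p = of_nat n + a" and "q = of_nat n + b"
    and "w = of_nat (Suc n) + a + b"
  define m where "m = (of_nat n :: complex)"
  define B where "B = ((of_nat k + a) gchoose k) * ((of_nat k + b) gchoose k)"
  have "m \<noteq> 0" "t \<noteq> 0"
    unfolding m_def t_def n_def by (rule of_nat_neq_0)+
  moreover have "w \<noteq> 0" "N n \<noteq> 0"
    unfolding w_def n_def by (rule ab_regular N_nonzero)+
  ultimately have nz: "m \<noteq> 0" "t \<noteq> 0" "w \<noteq> 0" "N n \<noteq> 0" .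
  have B: "m\<^sup>2 * (((of_nat n + a) gchoose n) * ((of_nat n + b) gchoose n)) = p * q * B"
  proof -
    have "m * ((of_nat n + d) gchoose n) = (of_nat n + d) * ((of_nat k + d) gchoose k)" for d :: complex
      using gbinomial_absorption[of k "of_nat n + d"] unfolding m_def n_def by simp
    from this[of a] this[of b] show ?thesis
      unfolding p_def q_def B_def power2_eq_square
      by (metis (no_types, opaque_lifting) mult.assoc mult.left_commute)
  qed
  have IH: "disc_const n * B = m\<^sup>2 * N n ^ n * (-1) ^ (n choose 2) * \<rho> k"
    using Suc.IH unfolding n_def m_def B_def .
  have step: "disc_const (Suc n) * (N n ^ (2 * n) * w ^ n * t ^ n)
     = disc_const n * (l n)\<^sup>2 * N (Suc n) ^ (2 * n + 1) * t\<^sup>2 * (p * q) ^ (n - 1)"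
    using disc_const_Suc[of n] unfolding w_def t_def p_def q_def n_def by simp
  have \<gamma>: "\<gamma> n = p * q * N (Suc n) / (N n * t * w)"
    unfolding \<gamma>_def p_def q_def t_def w_def ..
  have pow2: "z ^ (2 * n) = z ^ n * z ^ n" for z :: complex
    by (simp only: mult_2 power_add)
  have sign: "(-1 :: complex) ^ (Suc n choose 2) = (-1) ^ n * (-1) ^ (n choose 2)"
    by (simp add: numeral_2_eq_2 power_add)
  have "m\<^sup>2 * (N n ^ (2 * n) * w ^ n * t ^ n)
          * (disc_const (Suc n) * (((of_nat n + a) gchoose n) * ((of_nat n + b) gchoose n)))
      = (disc_const (Suc n) * (N n ^ (2 * n) * w ^ n * t ^ n)) * (p * q * B)"
    unfolding B[symmetric] by (simp only: mult_ac)
  also have "\<dots> = (disc_const n * B) * (l n)\<^sup>2 * N (Suc n) ^ (2 * n + 1) * t\<^sup>2 * (p * q * (p * q) ^ (n - 1))"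
    unfolding step by (simp only: mult_ac)
  also have "p * q * (p * q) ^ (n - 1) = (p * q) ^ n"
    unfolding n_def by simp
  also have "(disc_const n * B) * (l n)\<^sup>2 * N (Suc n) ^ (2 * n + 1) * t\<^sup>2 * (p * q) ^ n
      = m\<^sup>2 * (-1) ^ (n choose 2) * \<rho> k * (l n)\<^sup>2 * N (Suc n) ^ Suc n * t\<^sup>2
          * (N n ^ n * (p * q * N (Suc n)) ^ n)"
    unfolding IH power_mult_distrib[of "p * q"] Suc_eq_plus1 power_add power_one_right pow2
    by (simp only: mult_ac)
  also have "(p * q * N (Suc n)) ^ n = (N n * t * w) ^ n * \<gamma> n ^ n"
    unfolding power_mult_distrib[symmetric] \<gamma> using nz by simp
  also have "m\<^sup>2 * (-1) ^ (n choose 2) * \<rho> k * (l n)\<^sup>2 * N (Suc n) ^ Suc n * t\<^sup>2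
          * (N n ^ n * ((N n * t * w) ^ n * \<gamma> n ^ n))
      = m\<^sup>2 * (N n ^ (2 * n) * w ^ n * t ^ n)
          * (t\<^sup>2 * N (Suc n) ^ Suc n * (-1) ^ (n choose 2) * ((l n)\<^sup>2 * \<gamma> n ^ n * \<rho> k))"
    unfolding pow2 by (simp only: power_mult_distrib mult_ac)
  finally have "disc_const (Suc n) * (((of_nat n + a) gchoose n) * ((of_nat n + b) gchoose n))
      = t\<^sup>2 * N (Suc n) ^ Suc n * (-1) ^ (n choose 2) * ((l n)\<^sup>2 * \<gamma> n ^ n * \<rho> k)"
    using nz by (simp only: mult_cancel_left mult_eq_0_iff power_eq_0_iff) simp
  also have "(l n)\<^sup>2 * \<gamma> n ^ n * \<rho> k = (-1) ^ n * \<rho> n"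
  proof -
    have "\<gamma> n ^ n = (-1) ^ n * (- \<gamma> n) ^ n"
      unfolding power_mult_distrib[symmetric] by simp
    then show ?thesis
      unfolding \<rho>_Suc[of k, folded n_def] by (simp only: mult_ac)
  qed
  finally show ?case
    unfolding n_def[symmetric] sign t_def by (simp only: mult_ac)
qed

section \<open>The discriminant of quasi-Jacobi polynomials\<close>

text \<open>
  Adding \<open>c\<close> times the raising relation to the lowering relation and substituting
  \<open>P\<^sub>n = -c P\<^sub>n\<^sub>-\<^sub>1\<close> leaves a linear polynomial in \<open>r\<close> times
  \<open>P\<^sub>n\<^sub>-\<^sub>1(r)\<close>.  Its slope is \<open>N\<^sup>2 c\<close>, and \<open>y\<close> is its zero.
\<close>
lemma quasi_jacobi_pderiv_at_root:
  fixes c :: complex and k :: nat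
  assumes "c \<noteq> 0"
  defines "f \<equiv> P (Suc k) + smult c (P k)"
    and "n \<equiv> of_nat (Suc k)"
  defines "y \<equiv> - ((2 * n * (n + a + b) * c\<^sup>2 + (a\<^sup>2 - b\<^sup>2) * c + 2 * (n + a) * (n + b)) / ((2 * n + a + b)\<^sup>2 * c))"
  assumes "poly f r = 0"
  shows "(2 * n + a + b) * (1 - r\<^sup>2) * poly (pderiv f) r
           = (2 * n + a + b)\<^sup>2 * c * (r - y) * poly (P k) r"
proof -
  let ?M = "2 * n + a + b"
  have M: "?M \<noteq> 0"
    using N_nonzero[of k] unfolding n_def .
  have P: "poly (P (Suc k)) r = - c * poly (P k) r"
    using \<open>poly f r = 0\<close> by (simp add: f_def eq_neg_iff_add_eq_0)
  have "?M * (1 - r\<^sup>2) * poly (pderiv f) r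
      = ?M * (1 - r\<^sup>2) * poly (pderiv (P (Suc k))) r + c * (?M * (1 - r\<^sup>2) * poly (pderiv (P k)) r)"
    unfolding f_def by (simp add: pderiv_add pderiv_smult algebra_simps)
  also have "\<dots> = (?M\<^sup>2 * c * r + (2 * n * (n + a + b) * c\<^sup>2 + (a\<^sup>2 - b\<^sup>2) * c + 2 * (n + a) * (n + b)))
      * poly (P k) r"
    unfolding n_def jacobi_structure_lowering jacobi_structure_raising P
    unfolding n_def[symmetric] by (simp add: power2_eq_square algebra_simps)
  also have "?M\<^sup>2 * c * r + (2 * n * (n + a + b) * c\<^sup>2 + (a\<^sup>2 - b\<^sup>2) * c + 2 * (n + a) * (n + b))
      = ?M\<^sup>2 * c * (r - y)"
    unfolding y_def right_diff_distrib using M \<open>c \<noteq> 0\<close> by simp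
  finally show ?thesis .
qed

text \<open>
  The relation at a root is multiplied over all roots of \<open>f\<close>.  Of the products that arise, that of
  \<open>(1 - r) (-1 - r)\<close> is given by \<open>f(1) f(-1)\<close>, that of \<open>y - r\<close> by \<open>f(y)\<close>,
  that of \<open>f'(r)\<close> by the discriminant, and that of \<open>P\<^sub>n\<^sub>-\<^sub>1(r)\<close> by the resultant
  \<open>\<rho>\<close>.  Multiplied out in this way, the identity also covers the \<open>c\<close> for which
  \<open>f(1)\<close> or \<open>f(-1)\<close> is zero.
\<close>
lemma poly_disc_quasi_jacobi:
  fixes c :: complex and k :: nat
  assumes "c \<noteq> 0"
  defines "f \<equiv> P (Suc k) + smult c (P k)"
    and "n \<equiv> of_nat (Suc k)"
  defines "y \<equiv> - ((2 * n * (n + a + b) * c\<^sup>2 + (a\<^sup>2 - b\<^sup>2) * c + 2 * (n + a) * (n + b)) / ((2 * n + a + b)\<^sup>2 * c))"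
  shows "poly_disc f * ((n + a + c * n) * (n + b - c * n))
           = disc_const (Suc k) * ((- c) ^ Suc k * poly f y)"
proof -
  define M where "M = 2 * n + a + b"
  have M: "M \<noteq> 0"
    using N_nonzero[of k] unfolding M_def n_def .
  have n: "n \<noteq> 0"
    unfolding n_def by (rule of_nat_neq_0)
  have "degree (smult c (P k)) < degree (P (Suc k))"
    using degree_smult_le[of c "P k"] by simp
  then have degf: "degree f = Suc k" and "coeff f (Suc k) = l (Suc k)"
    unfolding f_def using degree_add_eq_left[of "smult c (P k)" "P (Suc k)"]
    by (auto simp: coeff_eq_0)
  then have leadf: "lead_coeff f = l (Suc k)"
    by simp
  have f0: "f \<noteq> 0" using degf by auto
  let ?R = "proots f" and ?L = "l (Suc k)"
  define D G where "D = (\<Prod>r\<in>#?R. poly (pderiv f) r)" and "G = (\<Prod>r\<in>#?R. poly (P k) r)"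
  define X Y Z where "X = (\<Prod>r\<in>#?R. 1 - r)" and "Y = (\<Prod>r\<in>#?R. -1 - r)" and "Z = (\<Prod>r\<in>#?R. y - r)"
  have size: "size ?R = Suc k"
    by (simp add: size_proots_complex degf)
  have XYZ: "?L * X = poly f 1" "?L * Y = poly f (-1)" "?L * Z = poly f y"
    unfolding X_def Y_def Z_def leadf[symmetric] by (simp_all only: poly_eq_prod_proots[of f])
  have "(\<Prod>r\<in>#?R. - M * ((1 - r) * ((-1 - r) * poly (pderiv f) r)))
      = (\<Prod>r\<in>#?R. - (M\<^sup>2 * c) * ((y - r) * poly (P k) r))"
  proof (intro arg_cong[of _ _ prod_mset] image_mset_cong)
    fix r assume "r \<in># ?R"
    then have "poly f r = 0" using f0 by simp
    then have root: "M * (1 - r\<^sup>2) * poly (pderiv f) r = M\<^sup>2 * c * (r - y) * poly (P k) r"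
      unfolding M_def y_def f_def n_def by (rule quasi_jacobi_pderiv_at_root[OF assms(1)])
    have "- M * ((1 - r) * ((-1 - r) * d)) = M * (1 - r\<^sup>2) * d" for d
      by (simp add: power2_eq_square algebra_simps)
    moreover have "M\<^sup>2 * c * (r - y) * d = - (M\<^sup>2 * c) * ((y - r) * d)" for d
      by (simp add: algebra_simps)
    ultimately show "- M * ((1 - r) * ((-1 - r) * poly (pderiv f) r)) = - (M\<^sup>2 * c) * ((y - r) * poly (P k) r)"
      using root by (simp only:)
  qed
  then have "(- M) ^ Suc k * (X * (Y * D)) = (- (M\<^sup>2 * c)) ^ Suc k * (Z * G)"
    unfolding prod_mset.distrib X_def Y_def Z_def D_def G_def by (simp add: size)
  moreover have "(- M) ^ Suc k = M ^ Suc k * (-1) ^ Suc k"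
    by (metis power_mult_distrib mult_minus1_right)
  moreover have "(- (M\<^sup>2 * c)) ^ Suc k = M ^ Suc k * (M ^ Suc k * (- c) ^ Suc k)"
    unfolding power_mult_distrib[symmetric] by (simp only: power2_eq_square mult_minus_right mult.assoc)
  ultimately have "M ^ Suc k * ((-1) ^ Suc k * (X * Y * D)) = M ^ Suc k * (M ^ Suc k * (- c) ^ Suc k * (Z * G))"
    by (simp only: mult.assoc)
  then have key: "(-1) ^ Suc k * (X * Y * D) = M ^ Suc k * (- c) ^ Suc k * (Z * G)"
    using M by (simp only: mult_cancel_left power_eq_0_iff) simp
  have disc: "?L\<^sup>2 * poly_disc f = (-1) ^ (Suc k choose 2) * ?L ^ Suc k * D"
    using poly_disc_eq_prod_pderiv[of f] unfolding leadf unfolding degf D_def by simp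
  \<comment> \<open>Reciprocity moves the product to the roots of \<open>P k\<close>, where \<open>f\<close> agrees with \<open>P (Suc k)\<close>.\<close>
  have G: "?L ^ k * G = \<rho> k"
  proof -
    have "(\<Prod>s\<in>#proots (P k). poly f s) = (\<Prod>s\<in>#proots (P k). poly (P (Suc k)) s)"
      by (intro arg_cong[of _ _ prod_mset] image_mset_cong) (auto simp: f_def)
    then show ?thesis
      using prod_proots_swap[of f "P k"] unfolding leadf \<rho>_def G_def unfolding degf by simp
  qed
  define Ca Cb where "Ca = (of_nat k + a) gchoose k" and "Cb = (of_nat k + b) gchoose k"
  have Cab: "Ca \<noteq> 0" "Cb \<noteq> 0"
    unfolding Ca_def Cb_def by (intro gbinomial_shift_nonzero a_regular b_regular)+
  have absorb: "n * ((of_nat (Suc k) + d) gchoose Suc k) = (n + d) * ((of_nat k + d) gchoose k)" for d :: complex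
    using gbinomial_absorption[of k "of_nat (Suc k) + d"] unfolding n_def by simp
  have f1: "n * poly f 1 = Ca * (n + a + c * n)"
    using absorb[of a] by (simp add: f_def jacobi_poly_at_1 Ca_def algebra_simps)
  have f2: "n * poly f (-1) = (-1) ^ Suc k * (Cb * (n + b - c * n))"
  proof -
    have "n * poly f (-1) = (-1) ^ Suc k * (n * ((of_nat (Suc k) + b) gchoose Suc k) - c * n * Cb)"
      unfolding f_def Cb_def by (simp add: jacobi_poly_at_minus_1 algebra_simps)
    also have "n * ((of_nat (Suc k) + b) gchoose Suc k) - c * n * Cb = Cb * (n + b - c * n)"
      unfolding absorb Cb_def by (simp add: algebra_simps)
    finally show ?thesis .
  qed
  have const: "disc_const (Suc k) * (Ca * Cb) = n\<^sup>2 * M ^ Suc k * (-1) ^ (Suc k choose 2) * \<rho> k"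
    unfolding Ca_def Cb_def disc_const_eq_\<rho> n_def M_def ..
  have sq: "(-1) ^ Suc k * ((-1) ^ Suc k * z) = z" for z :: complex
    unfolding mult.assoc[symmetric] power_mult_distrib[symmetric] by simp
  have "Ca * Cb * (poly_disc f * ((n + a + c * n) * (n + b - c * n)))
      = poly_disc f * (n * poly f 1) * ((-1) ^ Suc k * (n * poly f (-1)))"
    unfolding f1 f2 sq by (simp only: mult_ac)
  also have "\<dots> = n\<^sup>2 * (?L\<^sup>2 * poly_disc f) * ((-1) ^ Suc k * (X * Y))"
    unfolding XYZ[symmetric] by (simp only: power2_eq_square mult_ac)
  also have "\<dots> = n\<^sup>2 * (-1) ^ (Suc k choose 2) * ?L ^ Suc k * ((-1) ^ Suc k * (X * Y * D))"
    unfolding disc by (simp only: mult_ac)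
  also have "\<dots> = n\<^sup>2 * M ^ Suc k * (-1) ^ (Suc k choose 2) * (?L ^ k * G) * ((- c) ^ Suc k * (?L * Z))"
    unfolding key power_Suc[of ?L] by (simp only: mult_ac)
  also have "\<dots> = Ca * Cb * (disc_const (Suc k) * ((- c) ^ Suc k * poly f y))"
    unfolding G XYZ const[symmetric] by (simp only: mult_ac)
  finally show ?thesis
    using Cab by (simp only: mult_cancel_left mult_eq_0_iff) simp
qed

lemma poly_disc_quasi_jacobi_eq_poly:
  "\<exists>q. q \<noteq> 0 \<and> degree q = 2 * k \<and> (\<forall>c. poly_disc (P (Suc k) + smult c (P k)) = poly q c)"
  by (rule disc_pencil_eq_poly) (auto simp: no_common_root simple_roots)

end

theorem theorem4p3:
  fixes \<alpha> \<beta> :: real and n :: nat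
  assumes "\<alpha> > -1" "\<beta> > -1" "n \<ge> 1"
  defines "P \<equiv> \<lambda>c :: complex. quasi_jacobi_poly (of_real \<alpha>) (of_real \<beta>) n c"
  defines "A \<equiv> (2 * real n + \<alpha> + \<beta>) ^ (2 * n - 1) / 2 ^ (n * (n - 1))
               * (\<Prod>k=1..n. real k powi (int k - 2 * int n + 3))
               * (\<Prod>k=1..n-1. (real k + \<alpha>) ^ (k - 1) * (real k + \<beta>) ^ (k - 1)
                              * (real n + real k + \<alpha> + \<beta>) ^ (n - k - 1))"
  defines "x \<equiv> \<lambda>c :: complex.
               - ((2 * of_nat n * (of_nat n + of_real \<alpha> + of_real \<beta>) * c\<^sup>2
                   + ((of_real \<alpha>)\<^sup>2 - (of_real \<beta>)\<^sup>2) * c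
                   + 2 * (of_nat n + of_real \<alpha>) * (of_nat n + of_real \<beta>))
                  / ((2 * of_nat n + of_real \<alpha> + of_real \<beta>)\<^sup>2 * c))"
  defines "den \<equiv> \<lambda>c :: complex. (of_nat n + of_real \<alpha> + c * of_nat n)
                                * (of_nat n + of_real \<beta> - c * of_nat n)"
  defines "R \<equiv> \<lambda>c :: complex. of_real A * ((- c) ^ n * poly (P c) (x c) / den c)"
  shows "(\<forall>c. c \<noteq> 0 \<and> den c \<noteq> 0 \<longrightarrow> poly_disc (P c) = R c)
       \<and> (\<forall>c. c = 0 \<or> den c = 0 \<longrightarrow> (R \<longlongrightarrow> poly_disc (P c)) (at c))
       \<and> (\<exists>q :: complex poly. q \<noteq> 0 \<and> degree q = 2 * (n - 1)
                             \<and> (\<forall>c. poly_disc (P c) = poly q c))"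
proof -
  obtain k where n: "n = Suc k"
    using \<open>n \<ge> 1\<close> by (cases n) auto
  have shift: "of_nat m + complex_of_real z \<noteq> 0" if "real m + z > 0" for m z
  proof -
    have "complex_of_real (real m + z) \<noteq> 0"
      using that unfolding of_real_eq_0_iff by simp
    then show ?thesis by simp
  qed
  interpret regular_jacobi "of_real \<alpha>" "of_real \<beta>"
  proof
    fix k :: nat
    show "of_nat (Suc k) + complex_of_real \<alpha> \<noteq> 0" "of_nat (Suc k) + complex_of_real \<beta> \<noteq> 0"
      using shift[of "Suc k" \<alpha>] shift[of "Suc k" \<beta>] assms(1,2) by auto
    show "of_nat (Suc (Suc k)) + complex_of_real \<alpha> + complex_of_real \<beta> \<noteq> 0"
      using shift[of "Suc (Suc k)" "\<alpha> + \<beta>"] assms(1,2) by (simp add: add.assoc)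
  qed
  have A: "of_real A = disc_const n"
    unfolding A_def disc_const_def by simp
  have P: "P c = jacobi_poly (of_real \<alpha>) (of_real \<beta>) (Suc k) + smult c (jacobi_poly (of_real \<alpha>) (of_real \<beta>) k)" for c
    unfolding P_def quasi_jacobi_poly_def n by simp
  have formula: "poly_disc (P c) = R c" if "c \<noteq> 0" "den c \<noteq> 0" for c
  proof -
    have "poly_disc (P c) * den c = of_real A * ((- c) ^ n * poly (P c) (x c))"
      using poly_disc_quasi_jacobi[OF \<open>c \<noteq> 0\<close>, of k] unfolding A P den_def x_def n .
    with that show ?thesis
      unfolding R_def by (simp add: field_simps)
  qed
  obtain q where q: "q \<noteq> 0" "degree q = 2 * (n - 1)" "\<And>c. poly_disc (P c) = poly q c"
    using poly_disc_quasi_jacobi_eq_poly[of k] unfolding P n by auto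
  \<comment> \<open>Near any point \<open>R\<close> agrees with the polynomial \<open>q\<close>, except possibly at the point itself.\<close>
  have "(R \<longlongrightarrow> poly_disc (P c)) (at c)" for c
  proof -
    have "[:0, 1:] * ([:of_nat n + of_real \<alpha>, of_nat n:] * [:of_nat n + of_real \<beta>, - of_nat n :: complex:]) \<noteq> 0"
      (is "?d \<noteq> 0")
      unfolding n mult_eq_0_iff by (simp del: of_nat_Suc)
    then have "finite {z. poly ?d z = 0}"
      by (rule poly_roots_finite)
    moreover have "poly ?d z = z * den z" for z
      by (simp add: den_def algebra_simps)
    ultimately have "finite {z. z * den z = 0}"
      by (simp only:)
    then have "open (- ({z. z * den z = 0} - {c}))"
      by (intro open_Compl finite_imp_closed) auto
    then have "eventually (\<lambda>z. poly q z = R z) (at c)"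
      unfolding eventually_at_topological using formula q(3)
      by (intro exI[of _ "- ({z. z * den z = 0} - {c})"]) auto
    moreover have "(poly q \<longlongrightarrow> poly q c) (at c)"
      by (rule isContD[OF poly_isCont])
    ultimately show ?thesis
      unfolding q(3) by (rule Lim_transform_eventually[rotated])
  qed
  with formula q show ?thesis
    by blast
qed

end
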